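(* Let $\langle\mathcal S,P,c,\alpha\rangle$ be a Markov reward process on a finite state space $\mathcal S$ with $|\mathcal S|=N$, let $\mathcal M=\{1,\dots,L\}$ with $L\le N$, let $G=(g_{xk})_{x\in\mathcal S,k\in\mathcal M}$ be a non-negative row-stochastic $N\times L$ matrix, and let $U=(u_{lx})_{l\in\mathcal M,x\in\mathcal S}$ be a non-negative row-stochastic $L\times N$ matrix. Consider the Markov chain on $\mathcal S$ with transition matrix $$\widetilde P=PGU,\qquad \widetilde P_{xy}=\sum_{z\in\mathcal S,\,l\in\mathcal M}p_{xz}\,g_{zl}\,u_{ly},$$ and let $\widetilde V$ be its value function, i.e. the value of $\langle\mathcal S,\widetilde P,c,\alpha\rangle$. Let $R:\mathcal M\to\mathbb R$ be the aggregate value, i.e. the solution of $$R(l)=\sum_{x\in\mathcal S}u_{lx}\Big(c(x)+\alpha\sum_{y\in\mathcal S}p_{xy}\sum_{k\in\mathcal M}g_{yk}R(k)\Big),\qquad l\in\mathcal M.$$ Then $R=U\widetilde V$ and $\widetilde V=c+\alpha PGR$.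
   Context: A Markov reward process $\langle\mathcal S,P,c,\alpha\rangle$ consists of a finite state space $\mathcal S\subseteq\mathbb Z^d\cap\times_{i=1}^d[\ell_i,u_i]$, a transition matrix $P=(p_{xy})$ on $\mathcal S$, a cost function $c:\mathcal S\to\mathbb R_+$ (in the paper also norm-like: for some $k\in\mathbb Z_+$ and $\Gamma>0$, $\frac1\Gamma\|x\|^k\le c(x)\le\Gamma(1+\|x\|)^k$), and a discount factor $\alpha\in(0,1)$. Its value is $V(x)=\mathbb E_x\big[\sum_{t=0}^\infty\alpha^tc(X_t)\big]$, equivalently the unique solution of $V=c+\alpha PV$. Functions on $\mathcal S$ and $\mathcal M$ are treated as column vectors. $G$ is the matrix of aggregation probabilities and $U$ the matrix of disaggregation probabilities. *)

theory Defs
  imports "HOL-Analysis.Analysis" "HOL-Probability.Probability"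
begin

text \<open>Matrices and functions on finite index sets are total functions; only their values on the
  index sets matter.\<close>

definition row_stochastic :: "'a set \<Rightarrow> 'b set \<Rightarrow> ('a \<Rightarrow> 'b \<Rightarrow> real) \<Rightarrow> bool" where
  "row_stochastic A B Q \<longleftrightarrow> (\<forall>x\<in>A. (\<forall>y\<in>B. 0 \<le> Q x y) \<and> (\<Sum>y\<in>B. Q x y) = 1)"

definition markov_reward_process ::
    "(int ^ 'd) set \<Rightarrow> (int ^ 'd \<Rightarrow> int ^ 'd \<Rightarrow> real) \<Rightarrow> (int ^ 'd \<Rightarrow> real) \<Rightarrow> real \<Rightarrow> bool" where
  "markov_reward_process S P c \<alpha> \<longleftrightarrow>
     (\<exists>l u. \<forall>x\<in>S. \<forall>i. l $ i \<le> x $ i \<and> x $ i \<le> u $ i) \<and>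
     row_stochastic S S P \<and> (\<forall>x\<in>S. 0 \<le> c x) \<and> 0 < \<alpha> \<and> \<alpha> < 1"

text \<open>The law of the chain started in \<open>x\<close>, as a measure on the trajectories \<open>nat \<Rightarrow> S\<close>: it is the
  Ionescu-Tulcea limit of the kernels giving the law of \<open>X\<^sub>t\<close> from the values of \<open>X\<^sub>0, \<dots>, X\<^sub>t\<^sub>-\<^sub>1\<close>.
  Lemma \<open>markov_path_measure_cylinder\<close> gives its finite-dimensional distributions.\<close>

definition markov_kernel ::
    "'a set \<Rightarrow> ('a \<Rightarrow> 'a \<Rightarrow> real) \<Rightarrow> 'a \<Rightarrow> nat \<Rightarrow> (nat \<Rightarrow> 'a) \<Rightarrow> 'a measure" where
  "markov_kernel S P x t \<omega> =
     (case t of 0 \<Rightarrow> return (count_space S) x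
      | Suc s \<Rightarrow> point_measure S (\<lambda>y. ennreal (P (\<omega> s) y)))"

definition markov_path_measure ::
    "'a set \<Rightarrow> ('a \<Rightarrow> 'a \<Rightarrow> real) \<Rightarrow> 'a \<Rightarrow> (nat \<Rightarrow> 'a) measure" where
  "markov_path_measure S P x =
     projective_family.lim UNIV (Ionescu_Tulcea.CI (markov_kernel S P x) (\<lambda>_. count_space S))
       (\<lambda>_. count_space S)"

definition mrp_value ::
    "'a set \<Rightarrow> ('a \<Rightarrow> 'a \<Rightarrow> real) \<Rightarrow> ('a \<Rightarrow> real) \<Rightarrow> real \<Rightarrow> 'a \<Rightarrow> real" where
  "mrp_value S P c \<alpha> x = (\<integral>\<omega>. (\<Sum>t. \<alpha> ^ t * c (\<omega> t)) \<partial>markov_path_measure S P x)"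

text \<open>\<open>P\<close> followed by aggregation \<open>G\<close> and disaggregation \<open>U\<close>.\<close>

definition aggregated_transition ::
    "'a set \<Rightarrow> 'm set \<Rightarrow> ('a \<Rightarrow> 'a \<Rightarrow> real) \<Rightarrow> ('a \<Rightarrow> 'm \<Rightarrow> real) \<Rightarrow> ('m \<Rightarrow> 'a \<Rightarrow> real) \<Rightarrow>
      'a \<Rightarrow> 'a \<Rightarrow> real" where
  "aggregated_transition S M P G U x y = (\<Sum>z\<in>S. \<Sum>l\<in>M. P x z * G z l * U l y)"

text \<open>The solution of the aggregate equation is unique only as a function on \<open>M\<close>; restricting to
  \<open>extensional M\<close> pins down the irrelevant values outside \<open>M\<close>.\<close>

definition aggregate_value ::
    "'a set \<Rightarrow> 'm set \<Rightarrow> ('a \<Rightarrow> 'a \<Rightarrow> real) \<Rightarrow> ('a \<Rightarrow> 'm \<Rightarrow> real) \<Rightarrow> ('m \<Rightarrow> 'a \<Rightarrow> real) \<Rightarrow>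
      ('a \<Rightarrow> real) \<Rightarrow> real \<Rightarrow> 'm \<Rightarrow> real" where
  "aggregate_value S M P G U c \<alpha> =
     (THE R. R \<in> extensional M \<and>
        (\<forall>l\<in>M. R l = (\<Sum>x\<in>S. U l x * (c x + \<alpha> * (\<Sum>y\<in>S. P x y * (\<Sum>k\<in>M. G y k * R k))))))"

lemma Ionescu_Tulcea_markov_kernel:
  assumes S: "finite S" "row_stochastic S S P" and x: "x \<in> S"
  shows "Ionescu_Tulcea (markov_kernel S P x) (\<lambda>_. count_space S)"
proof (rule Ionescu_Tulcea.intro)
  have ps: "prob_space (point_measure S (\<lambda>y. ennreal (P z y)))" if "z \<in> S" for z
  proof (rule prob_spaceI)
    have "emeasure (point_measure S (\<lambda>y. ennreal (P z y))) S = (\<Sum>y\<in>S. ennreal (P z y))"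
      using S by (simp add: emeasure_point_measure_finite)
    also have "\<dots> = ennreal (\<Sum>y\<in>S. P z y)"
      using S that by (intro sum_ennreal) (auto simp: row_stochastic_def)
    also have "\<dots> = 1"
      using S that by (simp add: row_stochastic_def)
    finally show "emeasure (point_measure S (\<lambda>y. ennreal (P z y)))
        (space (point_measure S (\<lambda>y. ennreal (P z y)))) = 1"
      by (simp add: space_point_measure)
  qed
  show "prob_space (markov_kernel S P x t \<omega>)"
    if "\<omega> \<in> space (PiM {0..<t} (\<lambda>_. count_space S))" for t \<omega>
    using that x
    by (cases t) (auto simp: markov_kernel_def space_PiM intro!: prob_space_return ps)
  show "markov_kernel S P x t \<in> measurable (PiM {0..<t} (\<lambda>_. count_space S))
          (subprob_algebra (count_space S))" for t
  proof (cases t)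
    case 0
    have "return (count_space S) x \<in> space (subprob_algebra (count_space S))"
      using x by (auto simp: space_subprob_algebra intro!: prob_space_imp_subprob_space prob_space_return)
    then show ?thesis
      using 0 by (simp add: markov_kernel_def[abs_def])
  next
    case (Suc s)
    have "(\<lambda>z. point_measure S (\<lambda>y. ennreal (P z y)))
        \<in> measurable (count_space S) (subprob_algebra (count_space S))"
      using ps by (auto simp: space_subprob_algebra sets_point_measure intro: prob_space_imp_subprob_space)
    from measurable_compose[OF _ this]
    have "(\<lambda>\<omega>. point_measure S (\<lambda>y. ennreal (P (\<omega> s) y)))
        \<in> measurable (PiM {0..<t} (\<lambda>_. count_space S)) (subprob_algebra (count_space S))"
      if "(\<lambda>\<omega>. \<omega> s) \<in> measurable (PiM {0..<t} (\<lambda>_. count_space S)) (count_space S)"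
      using that .
    moreover have "(\<lambda>\<omega>. \<omega> s) \<in> measurable (PiM {0..<t} (\<lambda>_. count_space S)) (count_space S)"
      using Suc by (intro measurable_component_singleton) auto
    ultimately show ?thesis
      using Suc by (simp add: markov_kernel_def[abs_def])
  qed
qed

lemma prob_space_markov_path_measure:
  assumes "finite S" "row_stochastic S S P" "x \<in> S"
  shows "prob_space (markov_path_measure S P x)"
proof -
  interpret Ionescu_Tulcea "markov_kernel S P x" "\<lambda>_. count_space S"
    using assms by (rule Ionescu_Tulcea_markov_kernel)
  have "emeasure PF.lim (space PF.lim) = 1"
    using lim[of "{}" "space (PiM {} (\<lambda>_. count_space S))"]
      prob_space.emeasure_space_1[OF PF.prob_space_P[of "{}"]]
    by (simp add: PF.space_lim PF.space_P prod_emb_def space_PiM restrict_def PiM_empty)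
  then show ?thesis
    by (auto simp: markov_path_measure_def intro: prob_spaceI)
qed

lemma markov_path_measure_cylinder:
  assumes S: "finite S" "row_stochastic S S P" "x \<in> S" and xs: "\<And>i. i \<le> n \<Longrightarrow> xs i \<in> S"
  shows "measure (markov_path_measure S P x)
           {\<omega> \<in> space (markov_path_measure S P x). \<forall>i\<le>n. \<omega> i = xs i} =
         (if xs 0 = x then (\<Prod>i<n. P (xs i) (xs (Suc i))) else 0)"
proof -
  interpret IT: Ionescu_Tulcea "markov_kernel S P x" "\<lambda>_. count_space S"
    using S by (rule Ionescu_Tulcea_markov_kernel)
  have markov_kernel_0: "markov_kernel S P x 0 \<omega> = return (count_space S) x"
    and markov_kernel_Suc: "markov_kernel S P x (Suc s) \<omega> = point_measure S (\<lambda>y. ennreal (P (\<omega> s) y))"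
    for s \<omega>
    by (simp_all add: markov_kernel_def)
  let ?M = "\<lambda>n. PiM {0..<n} (\<lambda>_. count_space S)"
  let ?w = "\<lambda>n. restrict xs {0..<n}"
  have sing: "{?w m} \<in> sets (?M m)" "?w m \<in> space (?M m)" if "m \<le> Suc n" for m
  proof -
    have "{?w m} = PiE {0..<m} (\<lambda>i. {xs i})"
      by (auto simp: PiE_def Pi_def extensional_def restrict_def fun_eq_iff)
    also have "\<dots> \<in> sets (?M m)"
      using xs that by (intro sets_PiM_I_finite) auto
    finally show "{?w m} \<in> sets (?M m)" .
    show "?w m \<in> space (?M m)"
      using xs that by (auto simp: space_PiM)
  qed
  have C: "emeasure (IT.C 0 (Suc m) (\<lambda>_. undefined)) {?w (Suc m)} =
      ennreal (if xs 0 = x then (\<Prod>i<m. P (xs i) (xs (Suc i))) else 0)" if "m \<le> n" for m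
    using that
  proof (induction m)
    case 0
    have "(\<lambda>xa. (\<lambda>_. undefined)(0 := xa)) -` {?w (Suc 0)} \<inter> S = {xs 0}"
      using xs[of 0] by (auto simp: fun_eq_iff split: if_splits)
    moreover have "emeasure (IT.C 0 (Suc 0) (\<lambda>_. undefined)) {?w (Suc 0)} =
        emeasure (IT.eP 0 (\<lambda>_. undefined)) {?w (Suc 0)}"
      using bind_return[OF IT.measurable_eP[of 0], of "\<lambda>_. undefined"]
      by (simp add: space_PiM)
    moreover have "emeasure (IT.eP 0 (\<lambda>_. undefined)) {?w (Suc 0)} =
        emeasure (return (count_space S) x)
          ((\<lambda>xa. (\<lambda>_. undefined)(0 := xa)) -` {?w (Suc 0)} \<inter> S)"
      using sing[of "Suc 0"] by (subst IT.emeasure_eP) (auto simp: space_PiM markov_kernel_0)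
    ultimately have "emeasure (IT.C 0 (Suc 0) (\<lambda>_. undefined)) {?w (Suc 0)} =
        emeasure (return (count_space S) x) {xs 0}"
      by argo
    then show ?case
      using xs[of 0] by (simp only: emeasure_return) (simp add: indicator_def del: IT.C.simps restrict_apply)
  next
    case (Suc m)
    have "emeasure (IT.eP (Suc m) \<omega>) {?w (Suc (Suc m))} =
        ennreal (P (xs m) (xs (Suc m))) * indicator {?w (Suc m)} \<omega>"
      if \<omega>: "\<omega> \<in> space (?M (Suc m))" for \<omega>
    proof -
      have "(fun_upd \<omega> (Suc m)) -` {?w (Suc (Suc m))} \<inter> S = (if \<omega> = ?w (Suc m) then {xs (Suc m)} else {})"
      proof -
        have "fun_upd \<omega> (Suc m) y = ?w (Suc (Suc m)) \<longleftrightarrow> \<omega> = ?w (Suc m) \<and> y = xs (Suc m)" for y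
        proof
          assume eq: "fun_upd \<omega> (Suc m) y = ?w (Suc (Suc m))"
          have "y = xs (Suc m)"
            using fun_cong[OF eq, of "Suc m"] by simp
          moreover have "\<omega> = ?w (Suc m)"
          proof
            fix i show "\<omega> i = ?w (Suc m) i"
              using fun_cong[OF eq, of i] \<omega>
              by (cases "i < Suc m") (auto simp: space_PiM PiE_def extensional_def)
          qed
          ultimately show "\<omega> = ?w (Suc m) \<and> y = xs (Suc m)" by simp
        qed (auto simp: fun_eq_iff)
        then show ?thesis
          using xs[of "Suc m"] Suc.prems by auto
      qed
      then show ?thesis
        using \<omega> sing[of "Suc (Suc m)"] Suc.prems xs[of "Suc m"] S
        by (simp add: IT.emeasure_eP markov_kernel_Suc emeasure_point_measure_finite)
    qed
    moreover have "emeasure (IT.C 0 (Suc (Suc m)) (\<lambda>_. undefined)) {?w (Suc (Suc m))} =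
        (\<integral>\<^sup>+\<omega>. emeasure (IT.eP (Suc m) \<omega>) {?w (Suc (Suc m))} \<partial>IT.C 0 (Suc m) (\<lambda>_. undefined))"
      using sing[of "Suc (Suc m)"] Suc.prems
      apply (subst IT.C.simps(2))
      apply (subst emeasure_bind[where N = "?M (Suc (Suc m))"])
      using IT.space_C[of "\<lambda>_. undefined" 0 "Suc m"] IT.measurable_eP[of "Suc m"]
        IT.sets_C[of "\<lambda>_. undefined" 0 "Suc m"]
      using \<open>x \<in> S\<close>
      by (auto simp del: IT.C.simps simp: space_PiM PiE_eq_empty_iff cong: measurable_cong_sets)
    ultimately have "emeasure (IT.C 0 (Suc (Suc m)) (\<lambda>_. undefined)) {?w (Suc (Suc m))} =
        (\<integral>\<^sup>+\<omega>. ennreal (P (xs m) (xs (Suc m))) * indicator {?w (Suc m)} \<omega>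
           \<partial>IT.C 0 (Suc m) (\<lambda>_. undefined))"
      using IT.space_C[of "\<lambda>_. undefined" 0 "Suc m"]
      by (auto simp del: IT.C.simps simp: space_PiM intro!: nn_integral_cong)
    also have "\<dots> = ennreal (P (xs m) (xs (Suc m))) *
        emeasure (IT.C 0 (Suc m) (\<lambda>_. undefined)) {?w (Suc m)}"
      using sing(1)[of "Suc m"] Suc.prems IT.sets_C[of "\<lambda>_. undefined" 0 "Suc m"]
      by (intro nn_integral_cmult_indicator) (auto simp del: IT.C.simps simp: space_PiM)
    also have "\<dots> = ennreal (if xs 0 = x then (\<Prod>i<Suc m. P (xs i) (xs (Suc i))) else 0)"
    proof -
      have "0 \<le> P (xs m) (xs (Suc m))"
        using S xs[of m] xs[of "Suc m"] Suc.prems by (auto simp: row_stochastic_def)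
      then have "ennreal (q * P (xs m) (xs (Suc m))) = ennreal (P (xs m) (xs (Suc m))) * ennreal q" for q
        by (simp add: ennreal_mult'' mult.commute)
      moreover have "emeasure (IT.C 0 (Suc m) (\<lambda>_. undefined)) {?w (Suc m)} =
          ennreal (if xs 0 = x then (\<Prod>i<m. P (xs i) (xs (Suc i))) else 0)"
        using Suc.IH Suc.prems by linarith
      ultimately show ?thesis
        by (simp del: IT.C.simps)
    qed
    finally show ?case .
  qed
  have "restrict \<omega> {0..<Suc n} = ?w (Suc n) \<longleftrightarrow> (\<forall>i\<le>n. \<omega> i = xs i)" for \<omega>
    by (auto simp: less_Suc_eq_le intro!: restrict_ext) (metis atLeastLessThan_iff le0 less_Suc_eq_le restrict_apply')
  then have "{\<omega> \<in> space IT.PF.lim. \<forall>i\<le>n. \<omega> i = xs i} = IT.PF.emb UNIV {0..<Suc n} {?w (Suc n)}"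
    by (auto simp: prod_emb_def IT.PF.space_lim space_PiM)
  then have "emeasure IT.PF.lim {\<omega> \<in> space IT.PF.lim. \<forall>i\<le>n. \<omega> i = xs i} =
      emeasure (IT.C 0 (Suc n) (\<lambda>_. undefined)) {?w (Suc n)}"
    using sing[of "Suc n"] prod_emb_id[of "{?w (Suc n)}" "{0..<Suc n}" "\<lambda>_. count_space S"]
    by (simp add: IT.lim IT.emeasure_CI[of _ "Suc n"] space_PiM del: IT.C.simps)
  with C[of n] show ?thesis
    using S xs
    by (auto simp: markov_path_measure_def measure_def row_stochastic_def simp del: IT.C.simps
        intro!: enn2real_ennreal prod_nonneg)
qed

end

theory Submission
  imports Defs
begin

text \<open>The value of a chain with kernel \<open>Q\<close> is \<open>\<Sum>t. \<alpha>\<^sup>t Q\<^sup>t c\<close>, hence satisfies the Bellman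
  equation. For \<open>Q = PGU\<close> this reads \<open>V = c + \<alpha>PG(UV)\<close>; applying \<open>U\<close> shows that \<open>UV\<close> solves the
  aggregate equation, whose solution is unique because averaging followed by multiplication by
  \<open>\<alpha>\<close> is a contraction in the supremum norm.\<close>

section \<open>Stochastic matrices as averaging operators\<close>

text \<open>Row and column indices have separate types, so that one operator serves
  \<open>P\<close>, \<open>G\<close>, \<open>U\<close> and the product \<open>PGU\<close>.\<close>

definition kernel_apply :: "'b set \<Rightarrow> ('a \<Rightarrow> 'b \<Rightarrow> real) \<Rightarrow> ('b \<Rightarrow> real) \<Rightarrow> 'a \<Rightarrow> real" where
  "kernel_apply B Q f x = (\<Sum>y\<in>B. Q x y * f y)"

lemma kernel_apply_cong:
  "(\<And>y. y \<in> B \<Longrightarrow> f y = g y) \<Longrightarrow> kernel_apply B Q f x = kernel_apply B Q g x"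
  by (simp add: kernel_apply_def)

lemma kernel_apply_diff:
  "kernel_apply B Q (\<lambda>y. f y - g y) x = kernel_apply B Q f x - kernel_apply B Q g x"
  by (simp add: kernel_apply_def right_diff_distrib sum_subtractf)

text \<open>Non-negative weights with total 1 cannot enlarge a uniform bound. This makes every
  averaging step of the later contraction argument non-expansive.\<close>

lemma abs_kernel_apply_le:
  assumes "row_stochastic A B Q" "x \<in> A" "\<And>y. y \<in> B \<Longrightarrow> \<bar>f y\<bar> \<le> m"
  shows "\<bar>kernel_apply B Q f x\<bar> \<le> m"
proof -
  have nn: "0 \<le> Q x y" if "y \<in> B" for y
    using assms that by (auto simp: row_stochastic_def)
  have "\<bar>kernel_apply B Q f x\<bar> \<le> (\<Sum>y\<in>B. \<bar>Q x y * f y\<bar>)"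
    unfolding kernel_apply_def by (rule sum_abs)
  also have "\<dots> \<le> (\<Sum>y\<in>B. Q x y * m)"
    using nn assms(3) by (intro sum_mono) (simp add: abs_mult mult_left_mono)
  also have "\<dots> = m"
    using assms(1,2) by (simp add: row_stochastic_def flip: sum_distrib_right)
  finally show ?thesis .
qed

section \<open>Path sums and expectations under the path measure\<close>

text \<open>Induction on the horizon with \<open>f\<close> arbitrary: summing out the last state
  leaves the shorter paths, with \<open>f\<close> replaced by
  \<open>kernel_apply S P f\<close>.\<close>

lemma sum_paths_eq_kernel_power:
  assumes S: "finite S" "x \<in> S"
  shows "(\<Sum>xs\<in>{..n} \<rightarrow>\<^sub>E S. (if xs 0 = x then \<Prod>i<n. P (xs i) (xs (Suc i)) else 0) * f (xs n)) =
    (kernel_apply S P ^^ n) f x"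
proof (induction n arbitrary: f)
  case 0
  \<comment> \<open>A path of horizon 0 still has one coordinate, its start; all others are
    \<open>undefined\<close>.\<close>
  have "{..0::nat} \<rightarrow>\<^sub>E S = (\<lambda>y. (\<lambda>_. undefined)(0 := y)) ` S"
    by (auto simp: PiE_insert_eq)
  moreover have "inj_on (\<lambda>y. (\<lambda>_. undefined)(0 := y) :: nat \<Rightarrow> 'a) S"
    by (auto simp: inj_on_def fun_eq_iff split: if_splits)
  ultimately show ?case
    using S by (simp add: sum.reindex if_distrib[of "\<lambda>a. a * _"] cong: if_cong)
next
  case (Suc n)
  let ?w = "\<lambda>n xs. if xs 0 = x then \<Prod>i<n. P (xs i) (xs (Suc i)) else 0"
  \<comment> \<open>A path splits uniquely into its last state and the path before it.\<close>
  have "{..Suc n} \<rightarrow>\<^sub>E S = (\<lambda>(y, xs). xs(Suc n := y)) ` (S \<times> ({..n} \<rightarrow>\<^sub>E S))"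
    by (simp add: atMost_Suc PiE_insert_eq)
  moreover have "inj_on (\<lambda>(y, xs). xs(Suc n := y)) (S \<times> ({..n} \<rightarrow>\<^sub>E S))"
    by (rule inj_combinator) simp
  ultimately have "(\<Sum>xs\<in>{..Suc n} \<rightarrow>\<^sub>E S. ?w (Suc n) xs * f (xs (Suc n))) =
      (\<Sum>(y, xs)\<in>S \<times> ({..n} \<rightarrow>\<^sub>E S). ?w (Suc n) (xs(Suc n := y)) * f y)"
    by (simp add: sum.reindex case_prod_unfold del: prod.lessThan_Suc)
  also have "\<dots> = (\<Sum>(y, xs)\<in>S \<times> ({..n} \<rightarrow>\<^sub>E S). ?w n xs * P (xs n) y * f y)"
    by (intro sum.cong) auto
  also have "\<dots> = (\<Sum>xs\<in>{..n} \<rightarrow>\<^sub>E S. \<Sum>y\<in>S. ?w n xs * P (xs n) y * f y)"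
    by (simp add: sum.cartesian_product[symmetric] sum.swap[of _ S])
  also have "\<dots> = (\<Sum>xs\<in>{..n} \<rightarrow>\<^sub>E S. ?w n xs * kernel_apply S P f (xs n))"
    by (simp add: kernel_apply_def sum_distrib_left mult.assoc)
  \<comment> \<open>The hypothesis puts the extra application innermost, \<open>funpow\<close> puts
    it outermost; \<open>funpow_swap1\<close> reconciles them.\<close>
  also have "\<dots> = (kernel_apply S P ^^ Suc n) f x"
    using Suc.IH[of "kernel_apply S P f"] by (simp add: funpow_swap1)
  finally show ?case .
qed

context
  fixes S :: "'a set" and P :: "'a \<Rightarrow> 'a \<Rightarrow> real" and x :: 'a
  assumes S: "finite S" "row_stochastic S S P" "x \<in> S"
begin

lemma sets_markov_path_measure:
  "sets (markov_path_measure S P x) = sets (PiM UNIV (\<lambda>_. count_space S))"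
proof -
  interpret Ionescu_Tulcea "markov_kernel S P x" "\<lambda>_. count_space S"
    using S by (rule Ionescu_Tulcea_markov_kernel)
  show ?thesis
    by (simp add: markov_path_measure_def)
qed

lemma space_markov_path_measure: "space (markov_path_measure S P x) = (UNIV \<rightarrow>\<^sub>E S)"
  using sets_eq_imp_space_eq[OF sets_markov_path_measure] by (simp add: space_PiM)

lemma measurable_markov_path_component:
  "(\<lambda>\<omega>. f (\<omega> n)) \<in> borel_measurable (markov_path_measure S P x)"
  for f :: "'a \<Rightarrow> real"
proof -
  have "(\<lambda>\<omega>. \<omega> n) \<in> measurable (PiM UNIV (\<lambda>_. count_space S)) (count_space S)"
    by measurable
  then have "(\<lambda>\<omega>. f (\<omega> n)) \<in> borel_measurable (PiM UNIV (\<lambda>_. count_space S))"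
    by (rule measurable_compose) simp
  then show ?thesis
    by (simp cong: measurable_cong_sets add: sets_markov_path_measure)
qed

text \<open>Finitely many cylinders on times 0 to \<open>n\<close> partition the trajectories, so
  the integral is a finite sum of cylinder probabilities, each a product of transition
  probabilities.\<close>

lemma expectation_markov_path_component:
  fixes f :: "'a \<Rightarrow> real"
  shows "(\<integral>\<omega>. f (\<omega> n) \<partial>markov_path_measure S P x) = (kernel_apply S P ^^ n) f x"
proof -
  let ?M = "markov_path_measure S P x"
  interpret prob_space ?M
    using S by (rule prob_space_markov_path_measure)
  define cyl where "cyl xs = {\<omega> \<in> space ?M. \<forall>i\<le>n. \<omega> i = xs i}" for xs
  have fin: "finite ({..n} \<rightarrow>\<^sub>E S)"
    using S by (intro finite_PiE) auto
  have cyl_sets: "cyl xs \<in> sets ?M" for xs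
  proof -
    \<comment> \<open>Writing each coordinate condition through a real-valued indicator makes it a
      case of \<open>measurable_markov_path_component\<close>, even if \<open>xs i\<close> lies
      outside \<open>S\<close>.\<close>
    have [measurable]: "(\<lambda>\<omega>. indicat_real {xs i} (\<omega> i)) \<in> borel_measurable ?M" for i
      by (rule measurable_markov_path_component)
    have "{\<omega> \<in> space ?M. \<forall>i\<le>n. indicat_real {xs i} (\<omega> i) = 1} \<in> sets ?M"
      by measurable
    then show ?thesis
      unfolding cyl_def indicator_eq_1_iff singleton_iff .
  qed
  have "f (\<omega> n) = (\<Sum>xs\<in>{..n} \<rightarrow>\<^sub>E S. f (xs n) * indicator (cyl xs) \<omega>)"
    if \<omega>: "\<omega> \<in> space ?M" for \<omega>
  proof -
    have "restrict \<omega> {..n} \<in> {..n} \<rightarrow>\<^sub>E S"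
      using \<omega> by (auto simp: space_markov_path_measure)
    moreover have "\<omega> \<in> cyl xs \<longleftrightarrow> xs = restrict \<omega> {..n}" if "xs \<in> {..n} \<rightarrow>\<^sub>E S" for xs
      using that \<omega> by (auto simp: cyl_def fun_eq_iff PiE_def extensional_def)
    ultimately have "(\<Sum>xs\<in>{..n} \<rightarrow>\<^sub>E S. f (xs n) * indicator (cyl xs) \<omega>) =
        (\<Sum>xs\<in>{..n} \<rightarrow>\<^sub>E S. if xs = restrict \<omega> {..n} then f (\<omega> n) else 0)"
      by (intro sum.cong) (auto simp: indicator_def)
    then show ?thesis
      using fin \<open>restrict \<omega> {..n} \<in> {..n} \<rightarrow>\<^sub>E S\<close> by simp
  qed
  then have "(\<integral>\<omega>. f (\<omega> n) \<partial>?M) =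
      (\<integral>\<omega>. (\<Sum>xs\<in>{..n} \<rightarrow>\<^sub>E S. f (xs n) * indicator (cyl xs) \<omega>) \<partial>?M)"
    by (rule Bochner_Integration.integral_cong[OF refl])
  also have "\<dots> = (\<Sum>xs\<in>{..n} \<rightarrow>\<^sub>E S. f (xs n) * prob (cyl xs))"
    by (simp add: Bochner_Integration.integral_sum cyl_sets emeasure_eq_measure)
  also have "\<dots> = (\<Sum>xs\<in>{..n} \<rightarrow>\<^sub>E S.
      (if xs 0 = x then \<Prod>i<n. P (xs i) (xs (Suc i)) else 0) * f (xs n))"
  proof (rule sum.cong[OF refl])
    fix xs assume "xs \<in> {..n} \<rightarrow>\<^sub>E S"
    then have "xs i \<in> S" if "i \<le> n" for i
      using that by auto
    from markov_path_measure_cylinder[where n = n and xs = xs, OF S this, folded cyl_def]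
    show "f (xs n) * prob (cyl xs) =
        (if xs 0 = x then \<Prod>i<n. P (xs i) (xs (Suc i)) else 0) * f (xs n)"
      by simp
  qed
  also have "\<dots> = (kernel_apply S P ^^ n) f x"
    using S by (intro sum_paths_eq_kernel_power)
  finally show ?thesis .
qed

section \<open>Discounted series and the Bellman equation\<close>

text \<open>Costs are bounded on the finite set \<open>S\<close>, so a geometric series dominates
  the discounted costs and expectation may be exchanged with the sum over time.\<close>

lemma mrp_value_sums:
  assumes "0 < \<alpha>" "\<alpha> < 1"
  shows "(\<lambda>t. \<alpha> ^ t * (kernel_apply S P ^^ t) c x) sums mrp_value S P c \<alpha> x"
proof -
  \<comment> \<open>\<open>?C\<close> bounds the absolute cost of every state, hence along every
    trajectory.\<close>
  let ?M = "markov_path_measure S P x" and ?C = "\<Sum>y\<in>S. \<bar>c y\<bar>"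
  interpret prob_space ?M
    using S by (rule prob_space_markov_path_measure)
  have bound: "\<bar>\<alpha> ^ t * c (\<omega> t)\<bar> \<le> \<alpha> ^ t * ?C" if "\<omega> \<in> space ?M" for \<omega> t
  proof -
    have "\<bar>c (\<omega> t)\<bar> \<le> ?C"
      using that S by (intro member_le_sum) (auto simp: space_markov_path_measure)
    then show ?thesis
      using assms by (simp add: abs_mult)
  qed
  have meas: "(\<lambda>\<omega>. \<alpha> ^ t * c (\<omega> t)) \<in> borel_measurable ?M" for t
    using measurable_markov_path_component[of "\<lambda>y. \<alpha> ^ t * c y" t] .
  have geo: "summable (\<lambda>t. \<alpha> ^ t * ?C)"
    using assms by (intro summable_mult2 summable_geometric) auto
  have int: "integrable ?M (\<lambda>\<omega>. \<alpha> ^ t * c (\<omega> t))" for t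
    using bound meas by (intro integrable_const_bound[of _ "\<alpha> ^ t * ?C"]) auto
  have "(\<lambda>t. \<integral>\<omega>. \<alpha> ^ t * c (\<omega> t) \<partial>?M) sums (\<integral>\<omega>. (\<Sum>t. \<alpha> ^ t * c (\<omega> t)) \<partial>?M)"
  proof (rule sums_integral[OF int])
    show "AE \<omega> in ?M. summable (\<lambda>t. norm (\<alpha> ^ t * c (\<omega> t)))"
      using bound by (intro AE_I2 summable_comparison_test'[OF geo, of 0]) auto
    have "(\<integral>\<omega>. norm (\<alpha> ^ t * c (\<omega> t)) \<partial>?M) \<le> \<alpha> ^ t * ?C" for t
      using bound int[of t] by (intro integral_le_const) auto
    then show "summable (\<lambda>t. \<integral>\<omega>. norm (\<alpha> ^ t * c (\<omega> t)) \<partial>?M)"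
      by (intro summable_comparison_test'[OF geo, of 0]) (simp add: integral_nonneg_AE)
  qed
  then show ?thesis
    by (simp add: mrp_value_def expectation_markov_path_component)
qed

end

text \<open>Splitting off time 0 leaves the series of the successor values, averaged by
  \<open>P\<close> and discounted once; the average is a finite sum and so commutes with the
  series.\<close>

lemma mrp_value_bellman:
  assumes S: "finite S" "row_stochastic S S P" "x \<in> S" and \<alpha>: "0 < \<alpha>" "\<alpha> < 1"
  shows "mrp_value S P c \<alpha> x = c x + \<alpha> * kernel_apply S P (mrp_value S P c \<alpha>) x"
proof -
  let ?a = "\<lambda>t y. \<alpha> ^ t * (kernel_apply S P ^^ t) c y"
  have "(\<lambda>t. \<Sum>y\<in>S. P x y * ?a t y) sums kernel_apply S P (mrp_value S P c \<alpha>) x"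
    unfolding kernel_apply_def[of _ _ "mrp_value S P c \<alpha>"]
    by (rule sums_sum, rule sums_mult, rule mrp_value_sums[OF S(1,2) _ \<alpha>])
  then have "(\<lambda>t. \<alpha> * (\<Sum>y\<in>S. P x y * ?a t y)) sums
      (\<alpha> * kernel_apply S P (mrp_value S P c \<alpha>) x)"
    by (rule sums_mult)
  \<comment> \<open>One transition and one discount factor shift the time index by one.\<close>
  moreover have "\<alpha> * (\<Sum>y\<in>S. P x y * ?a t y) = ?a (Suc t) x" for t
    by (simp add: kernel_apply_def[of _ _ _ x] sum_distrib_left mult_ac)
  ultimately have "(\<lambda>t. ?a (Suc t) x) sums (\<alpha> * kernel_apply S P (mrp_value S P c \<alpha>) x)"
    by simp
  then have "(\<lambda>t. ?a t x) sums (\<alpha> * kernel_apply S P (mrp_value S P c \<alpha>) x + ?a 0 x)"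
    by (rule sums_Suc)
  from sums_unique2[OF mrp_value_sums[OF S \<alpha>] this] show ?thesis
    by simp
qed

section \<open>The aggregated chain\<close>

text \<open>Associativity of the matrix product. It exposes \<open>kernel_apply S U f\<close>, which
  for the value function is the candidate aggregate value.\<close>

lemma kernel_apply_aggregated_transition:
  "kernel_apply S (aggregated_transition S M P G U) f x =
    kernel_apply S P (kernel_apply M G (kernel_apply S U f)) x"
proof -
  have "kernel_apply S (aggregated_transition S M P G U) f x =
      (\<Sum>y\<in>S. \<Sum>z\<in>S. \<Sum>l\<in>M. P x z * (G z l * (U l y * f y)))"
    by (simp add: kernel_apply_def aggregated_transition_def sum_distrib_right mult.assoc)
  also have "\<dots> = (\<Sum>z\<in>S. \<Sum>l\<in>M. \<Sum>y\<in>S. P x z * (G z l * (U l y * f y)))"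
    by (subst sum.swap) (rule sum.cong[OF refl], rule sum.swap)
  finally show ?thesis
    by (simp add: kernel_apply_def sum_distrib_left)
qed

lemma row_stochastic_aggregated_transition:
  assumes "row_stochastic S S P" "row_stochastic S M G" "row_stochastic M S U"
  shows "row_stochastic S S (aggregated_transition S M P G U)"
  unfolding row_stochastic_def
proof (intro ballI conjI)
  fix x assume x: "x \<in> S"
  show "0 \<le> aggregated_transition S M P G U x y" if "y \<in> S" for y
    using assms x that
    by (auto simp: aggregated_transition_def row_stochastic_def intro!: sum_nonneg mult_nonneg_nonneg)
  \<comment> \<open>Row sums equal 1 exactly when the operator fixes the constant 1, a property that
    passes to products. Fresh index types allow its use for \<open>P\<close>, \<open>G\<close> and
    \<open>U\<close> alike.\<close>
  have one: "kernel_apply B Q (\<lambda>_. 1) a = 1" if "row_stochastic A B Q" "a \<in> A"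
    for A :: "'c set" and B :: "'e set" and Q a
    using that by (simp add: kernel_apply_def row_stochastic_def)
  have "kernel_apply S (aggregated_transition S M P G U) (\<lambda>_. 1) x = 1"
    using assms x
    by (simp add: kernel_apply_aggregated_transition one[of M] one[of S] cong: kernel_apply_cong)
  then show "(\<Sum>y\<in>S. aggregated_transition S M P G U x y) = 1"
    by (simp add: kernel_apply_def)
qed

section \<open>Uniqueness for the aggregate equation\<close>

text \<open>The costs cancel in the difference of two solutions, whose supremum norm
  \<open>m\<close> then satisfies \<open>m \<le> \<alpha> * m\<close>.\<close>

lemma aggregate_equation_unique:
  assumes M: "finite M"
    and stoch: "row_stochastic S S P" "row_stochastic S M G" "row_stochastic M S U"
    and \<alpha>: "0 < \<alpha>" "\<alpha> < 1"
    and R: "\<And>l. l \<in> M \<Longrightarrow>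
      R l = kernel_apply S U (\<lambda>x. c x + \<alpha> * kernel_apply S P (kernel_apply M G R) x) l"
    and R': "\<And>l. l \<in> M \<Longrightarrow>
      R' l = kernel_apply S U (\<lambda>x. c x + \<alpha> * kernel_apply S P (kernel_apply M G R') x) l"
    and l: "l \<in> M"
  shows "R l = R' l"
proof -
  define D where "D k = R k - R' k" for k
  define m where "m = Max ((\<lambda>k. \<bar>D k\<bar>) ` M)"
  have le_m: "\<bar>D k\<bar> \<le> m" if "k \<in> M" for k
    using M that by (simp add: m_def)
  have "\<bar>D k\<bar> \<le> \<alpha> * m" if k: "k \<in> M" for k
  proof -
    have "kernel_apply M G D = (\<lambda>y. kernel_apply M G R y - kernel_apply M G R' y)"
      unfolding D_def by (intro ext kernel_apply_diff)
    then have "\<alpha> * kernel_apply S P (kernel_apply M G D) x =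
        (c x + \<alpha> * kernel_apply S P (kernel_apply M G R) x) -
        (c x + \<alpha> * kernel_apply S P (kernel_apply M G R') x)" for x
      by (simp add: kernel_apply_diff right_diff_distrib)
    then have "kernel_apply S U (\<lambda>x. \<alpha> * kernel_apply S P (kernel_apply M G D) x) k = D k"
      unfolding D_def using R[OF k] R'[OF k] by (simp only: kernel_apply_diff)
    then have "D k = kernel_apply S U (\<lambda>x. \<alpha> * kernel_apply S P (kernel_apply M G D) x) k"
      by (rule sym)
    \<comment> \<open>Averaging by \<open>G\<close>, \<open>P\<close> and \<open>U\<close> keeps the
      bound \<open>m\<close>; only the discount contributes a factor.\<close>
    also have "\<bar>\<dots>\<bar> \<le> \<alpha> * m"
    proof (rule abs_kernel_apply_le[OF stoch(3) k])
      fix x assume "x \<in> S"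
      then have "\<bar>kernel_apply S P (kernel_apply M G D) x\<bar> \<le> m"
        using le_m by (intro abs_kernel_apply_le[OF stoch(1)] abs_kernel_apply_le[OF stoch(2)])
      then show "\<bar>\<alpha> * kernel_apply S P (kernel_apply M G D) x\<bar> \<le> \<alpha> * m"
        using \<alpha> by (simp add: abs_mult)
    qed
    finally show ?thesis .
  qed
  \<comment> \<open>\<open>l\<close> witnesses that the maximum is over a nonempty set.\<close>
  then have "m \<le> \<alpha> * m"
    using M l unfolding m_def by (subst Max_le_iff) auto
  then have "(1 - \<alpha>) * m \<le> 0"
    by (simp add: algebra_simps)
  then have "m \<le> 0"
    using \<alpha> by (simp add: mult_le_0_iff)
  with le_m[OF l] show ?thesis
    by (simp add: D_def)
qed

text \<open>By uniqueness any solution on \<open>M\<close> identifies the definite description; its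
  restriction to \<open>M\<close> is the extensional witness.\<close>

lemma aggregate_value_eqI:
  assumes M: "finite M"
    and stoch: "row_stochastic S S P" "row_stochastic S M G" "row_stochastic M S U"
    and \<alpha>: "0 < \<alpha>" "\<alpha> < 1"
    and R: "\<And>l. l \<in> M \<Longrightarrow>
      R l = kernel_apply S U (\<lambda>x. c x + \<alpha> * kernel_apply S P (kernel_apply M G R) x) l"
    and l: "l \<in> M"
  shows "aggregate_value S M P G U c \<alpha> l = R l"
proof -
  let ?sol = "\<lambda>R. \<forall>l\<in>M.
    R l = kernel_apply S U (\<lambda>x. c x + \<alpha> * kernel_apply S P (kernel_apply M G R) x) l"
  have "kernel_apply M G (restrict R M) = kernel_apply M G R"
    by (intro ext kernel_apply_cong) simp
  then have "?sol (restrict R M)"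
    using R by simp
  then have "(THE R. R \<in> extensional M \<and> ?sol R) = restrict R M"
  proof (intro the_equality conjI)
    fix R' assume R': "R' \<in> extensional M \<and> ?sol R'"
    have "R' k = R k" if "k \<in> M" for k
      by (rule aggregate_equation_unique[OF M stoch \<alpha> _ _ that, of _ c]) (use R R' in blast)+
    then show "R' = restrict R M"
      using R' by (intro extensionalityI[of _ M]) auto
  qed auto
  then show ?thesis
    using l by (simp add: aggregate_value_def kernel_apply_def)
qed

section \<open>Finiteness of the state space and conclusion\<close>

text \<open>\<open>markov_reward_process\<close> only confines the states to an integer box;
  finiteness of \<open>S\<close> is derived from this.\<close>

lemma finite_int_box:
  fixes l u :: "int ^ 'd"
  shows "finite {x. \<forall>i. l $ i \<le> x $ i \<and> x $ i \<le> u $ i}"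
proof (rule finite_subset)
  show "{x. \<forall>i. l $ i \<le> x $ i \<and> x $ i \<le> u $ i} \<subseteq> vec_lambda ` (\<Pi>\<^sub>E i\<in>UNIV. {l $ i..u $ i})"
  proof
    fix x assume "x \<in> {x. \<forall>i. l $ i \<le> x $ i \<and> x $ i \<le> u $ i}"
    then show "x \<in> vec_lambda ` (\<Pi>\<^sub>E i\<in>UNIV. {l $ i..u $ i})"
      by (intro image_eqI[of _ _ "vec_nth x"]) auto
  qed
  show "finite (vec_lambda ` (\<Pi>\<^sub>E i\<in>UNIV. {l $ i..u $ i}))"
    by (intro finite_imageI finite_PiE) auto
qed

theorem theorem1:
  fixes S :: "(int ^ 'd) set"
    and P :: "int ^ 'd \<Rightarrow> int ^ 'd \<Rightarrow> real"
    and c :: "int ^ 'd \<Rightarrow> real"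
    and \<alpha> :: real
    and N L :: nat
    and G :: "int ^ 'd \<Rightarrow> nat \<Rightarrow> real"
    and U :: "nat \<Rightarrow> int ^ 'd \<Rightarrow> real"
    and V :: "int ^ 'd \<Rightarrow> real"
    and R :: "nat \<Rightarrow> real"
  assumes "markov_reward_process S P c \<alpha>"
    and "card S = N"
    and "L \<le> N"
    and "row_stochastic S {1..L} G"
    and "row_stochastic {1..L} S U"
    and "V = mrp_value S (aggregated_transition S {1..L} P G U) c \<alpha>"
    and "R = aggregate_value S {1..L} P G U c \<alpha>"
  shows "(\<forall>l\<in>{1..L}. R l = (\<Sum>x\<in>S. U l x * V x)) \<and>
         (\<forall>x\<in>S. V x = c x + \<alpha> * (\<Sum>y\<in>S. P x y * (\<Sum>k\<in>{1..L}. G y k * R k)))"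
proof -
  let ?M = "{1..L}"
  obtain l u where "S \<subseteq> {x. \<forall>i. l $ i \<le> x $ i \<and> x $ i \<le> u $ i}"
    using assms(1) unfolding markov_reward_process_def by blast
  then have S: "finite S"
    by (rule finite_subset[OF _ finite_int_box])
  have P: "row_stochastic S S P" and \<alpha>: "0 < \<alpha>" "\<alpha> < 1"
    using assms(1) by (auto simp: markov_reward_process_def)
  \<comment> \<open>The candidate for \<open>R\<close>.\<close>
  define W where "W = kernel_apply S U V"
  have V: "V x = c x + \<alpha> * kernel_apply S P (kernel_apply ?M G W) x" if "x \<in> S" for x
    using mrp_value_bellman[OF S row_stochastic_aggregated_transition[OF P assms(4,5)] that \<alpha>, of c]
    by (simp add: assms(6) W_def kernel_apply_aggregated_transition)
  \<comment> \<open>Averaging the Bellman equation by \<open>U\<close> yields the aggregate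
    equation.\<close>
  have W: "W l = kernel_apply S U (\<lambda>x. c x + \<alpha> * kernel_apply S P (kernel_apply ?M G W) x) l" for l
    using V by (subst W_def) (rule kernel_apply_cong)
  have R: "R l = W l" if "l \<in> ?M" for l
    unfolding assms(7) by (rule aggregate_value_eqI[OF _ P assms(4,5) \<alpha> W that]) simp
  then have "kernel_apply ?M G W = kernel_apply ?M G R"
    by (intro ext kernel_apply_cong) simp
  with V have "V x = c x + \<alpha> * kernel_apply S P (kernel_apply ?M G R) x" if "x \<in> S" for x
    using that by metis
  with R show ?thesis
    unfolding W_def kernel_apply_def by blast
qed

end
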